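(* Let $N\ge 2$ be an integer, let $m_0,\dots,m_{N-1},\tilde m_0,\dots,\tilde m_{N-1}\in L^\infty(\mathbb{T})$, and define operators on $L^2(\mathbb{T})$ by $(S_if)(z)=m_i(z)f(z^N)$ and $(\tilde S_if)(z)=\tilde m_i(z)f(z^N)$ for $0\le i\le N-1$. Then the following three conditions are equivalent. (i) $S_i^*\tilde S_j=\delta_{i,j}I$ for all $0\le i,j\le N-1$, and $\sum_{i=0}^{N-1}S_i\tilde S_i^*=I$. (ii) The functions $m_0,\dots,m_{N-1},\tilde m_0,\dots,\tilde m_{N-1}$ are the filter functions for a biorthogonal wavelet of scale $N$; in other words, for almost every $z\in\mathbb{T}$ the matrices $$\frac{1}{\sqrt N}\Big(m_k\big(e^{i2\pi l/N}z\big)\Big)_{k,l=0}^{N-1}\quad\text{and}\quad \frac{1}{\sqrt N}\Big(\tilde m_k\big(e^{i2\pi l/N}z\big)\Big)_{k,l=0}^{N-1}$$ belong to $\mathrm{GL}_N(\mathbb{C})$ and the adjoint of one is the inverse of the other. (iii) The matrix functions $A=(A_{k,l})_{k,l=0}^{N-1}$ and $\tilde A=(\tilde A_{k,l})_{k,l=0}^{N-1}$ with entries $$A_{k,l}(z)=\frac1N\sum_{w^N=z}w^{-l}m_k(w),\qquad \tilde A_{k,l}(z)=\frac1N\sum_{w^N=z}w^{-l}\tilde m_k(w)$$ satisfy, for almost every $z\in\mathbb{T}$, $\sum_{k=0}^{N-1}\overline{A_{k,i}(z)}\,\tilde A_{k,j}(z)=\delta_{i,j}$ for all $0\le i,j\le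 N-1$, i.e. $A(z)^*\tilde A(z)=I$, or $\tilde A=(A^* )^{-1}$ pointwise almost everywhere.
   Context: $\mathbb{T}$ is the unit circle in $\mathbb{C}$ (identified with $\mathbb{R}/2\pi\mathbb{Z}$) with normalized Haar measure $\mu$. Sums over $w^N=z$ run over the $N$ points $w\in\mathbb{T}$ with $w^N=z$. In condition (ii), "filter functions for a biorthogonal wavelet of scale $N$" is the name for families of functions satisfying the matrix condition stated there; the matrix condition is the precise meaning. *)

theory Defs
  imports "HOL-Analysis.Analysis" "Jordan_Normal_Form.Schur_Decomposition"
begin

text \<open>
  The measure lives on the Borel sets of the unit circle of \<^typ>\<open>complex\<close>. Functions on the circle
  are functions \<^typ>\<open>complex \<Rightarrow> complex\<close> whose values off the circle are irrelevant.
\<close>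

definition circle_measure :: "complex measure" where
  "circle_measure =
     distr (uniform_measure lborel {0..<2 * pi}) (restrict_space borel (sphere 0 1)) cis"

definition Linf_circle :: "(complex \<Rightarrow> complex) set" where
  "Linf_circle =
     {m \<in> borel_measurable circle_measure. \<exists>C. AE z in circle_measure. cmod (m z) \<le> C}"

definition square_integrable :: "(complex \<Rightarrow> complex) \<Rightarrow> bool" where
  "square_integrable f \<longleftrightarrow>
     f \<in> borel_measurable circle_measure \<and> integrable circle_measure (\<lambda>z. (cmod (f z))\<^sup>2)"

definition l2_rel :: "(complex \<Rightarrow> complex) \<Rightarrow> (complex \<Rightarrow> complex) \<Rightarrow> bool" where
  "l2_rel f g \<longleftrightarrow>
     square_integrable f \<and> square_integrable g \<and> (AE z in circle_measure. f z = g z)"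

lemma square_integrable_zero: "square_integrable (\<lambda>_. 0)"
  by (simp add: square_integrable_def)

quotient_type l2_circle = "complex \<Rightarrow> complex" / partial: l2_rel
proof (rule part_equivpI)
  show "\<exists>f. l2_rel f f"
    using square_integrable_zero by (auto simp: l2_rel_def)
  show "symp l2_rel"
    by (rule sympI) (auto simp: l2_rel_def)
  show "transp l2_rel"
    by (rule transpI) (auto simp: l2_rel_def elim: AE_mp)
qed

lemma square_integrable_add:
  assumes "square_integrable f" "square_integrable g"
  shows "square_integrable (\<lambda>z. f z + g z)"
proof -
  have [measurable]: "f \<in> borel_measurable circle_measure" "g \<in> borel_measurable circle_measure"
    using assms by (auto simp: square_integrable_def)
  have "integrable circle_measure (\<lambda>z. 2 * (cmod (f z))\<^sup>2 + 2 * (cmod (g z))\<^sup>2)"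
    using assms by (auto simp: square_integrable_def)
  moreover have "(cmod (f z + g z))\<^sup>2 \<le> 2 * (cmod (f z))\<^sup>2 + 2 * (cmod (g z))\<^sup>2" for z
  proof -
    have "(cmod (f z + g z))\<^sup>2 \<le> (cmod (f z) + cmod (g z))\<^sup>2"
      by (intro power_mono norm_triangle_ineq) auto
    also have "\<dots> \<le> 2 * (cmod (f z))\<^sup>2 + 2 * (cmod (g z))\<^sup>2"
      using sum_squares_bound[of "cmod (f z)" "cmod (g z)"] by (simp add: power2_sum)
    finally show ?thesis .
  qed
  ultimately have "integrable circle_measure (\<lambda>z. (cmod (f z + g z))\<^sup>2)"
    by (auto intro: Bochner_Integration.integrable_bound)
  then show ?thesis
    by (simp add: square_integrable_def)
qed

lemma square_integrable_minus: "square_integrable f \<Longrightarrow> square_integrable (\<lambda>z. - f z)"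
  by (simp add: square_integrable_def)

lemma square_integrable_diff:
  "square_integrable f \<Longrightarrow> square_integrable g \<Longrightarrow> square_integrable (\<lambda>z. f z - g z)"
  using square_integrable_add[of f "\<lambda>z. - g z"] by (simp add: square_integrable_minus)

instantiation l2_circle :: ab_group_add
begin

lift_definition zero_l2_circle :: l2_circle is "\<lambda>_. 0"
  by (simp add: l2_rel_def square_integrable_zero)

lift_definition plus_l2_circle :: "l2_circle \<Rightarrow> l2_circle \<Rightarrow> l2_circle" is "\<lambda>f g z. f z + g z"
  by (auto simp: l2_rel_def square_integrable_add)

lift_definition uminus_l2_circle :: "l2_circle \<Rightarrow> l2_circle" is "\<lambda>f z. - f z"
  by (auto simp: l2_rel_def square_integrable_minus)

lift_definition minus_l2_circle :: "l2_circle \<Rightarrow> l2_circle \<Rightarrow> l2_circle" is "\<lambda>f g z. f z - g z"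
  by (auto simp: l2_rel_def square_integrable_diff)

instance
proof
  fix a b c :: l2_circle
  show "a + b + c = a + (b + c)"
    by transfer (auto simp: l2_rel_def add.assoc intro!: square_integrable_add)
  show "a + b = b + a"
    by transfer (auto simp: l2_rel_def add.commute intro!: square_integrable_add)
  show "0 + a = a"
    by transfer (auto simp: l2_rel_def)
  show "- a + a = 0"
    by transfer (auto simp: l2_rel_def square_integrable_zero)
  show "a - b = a + - b"
    by transfer
      (auto simp: l2_rel_def intro!: square_integrable_add square_integrable_minus
        square_integrable_diff)
qed

end

lift_definition l2_inner :: "l2_circle \<Rightarrow> l2_circle \<Rightarrow> complex" is
  "\<lambda>f g. \<integral>z. f z * cnj (g z) \<partial>circle_measure"
proof -
  fix f f' g g'
  assume "l2_rel f f'" "l2_rel g g'"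
  then have meas [measurable]:
      "f \<in> borel_measurable circle_measure" "f' \<in> borel_measurable circle_measure"
      "g \<in> borel_measurable circle_measure" "g' \<in> borel_measurable circle_measure"
    and ae: "AE z in circle_measure. f z = f' z" "AE z in circle_measure. g z = g' z"
    by (auto simp: l2_rel_def square_integrable_def)
  have "cnj \<in> borel_measurable borel"
    by (intro borel_measurable_continuous_onI continuous_intros)
  note [measurable] = measurable_compose[OF meas(3) this] measurable_compose[OF meas(4) this]
  have "AE z in circle_measure. f z * cnj (g z) = f' z * cnj (g' z)"
    using ae by eventually_elim simp
  then show "(\<integral>z. f z * cnj (g z) \<partial>circle_measure) = (\<integral>z. f' z * cnj (g' z) \<partial>circle_measure)"
    by (intro integral_cong_AE) auto
qed

text \<open>
  The Hilbert space adjoint. An operator admits at most one \<open>T\<close> as below, since \<^const>\<open>l2_inner\<close> is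
  definite, and a bounded operator admits one.
\<close>

definition l2_adjoint :: "(l2_circle \<Rightarrow> l2_circle) \<Rightarrow> l2_circle \<Rightarrow> l2_circle" where
  "l2_adjoint S = (THE T. \<forall>f g. l2_inner (S f) g = l2_inner f (T g))"


text \<open>
  For \<open>m\<close> in \<^const>\<open>Linf_circle\<close> and \<open>N > 0\<close> the class below does not depend on the chosen
  representative: see \<open>filter_op_abs\<close>.
\<close>

definition filter_op :: "nat \<Rightarrow> (complex \<Rightarrow> complex) \<Rightarrow> l2_circle \<Rightarrow> l2_circle" where
  "filter_op N m f = abs_l2_circle (\<lambda>z. m z * rep_l2_circle f (z ^ N))"

definition modulation_matrix :: "nat \<Rightarrow> (nat \<Rightarrow> complex \<Rightarrow> complex) \<Rightarrow> complex \<Rightarrow> complex mat" where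
  "modulation_matrix N m z =
     (1 / complex_of_real (sqrt (real N))) \<cdot>\<^sub>m
       mat N N (\<lambda>(k, l). m k (exp (\<i> * 2 * pi * of_nat l / of_nat N) * z))"

definition polyphase :: "nat \<Rightarrow> (nat \<Rightarrow> complex \<Rightarrow> complex) \<Rightarrow> nat \<Rightarrow> nat \<Rightarrow> complex \<Rightarrow> complex" where
  "polyphase N m k l z = (1 / of_nat N) * (\<Sum>w | w ^ N = z. w powi (- int l) * m k w)"

lemma measurable_cis_circle: "cis \<in> borel \<rightarrow>\<^sub>M restrict_space borel (sphere 0 1)"
  by (rule measurable_restrict_space2)
    (auto intro!: borel_measurable_continuous_onI continuous_intros)

lemma sets_circle_measure [measurable_cong]:
  "sets circle_measure = sets (restrict_space borel (sphere 0 1))"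
  by (simp add: circle_measure_def)

lemma space_circle_measure: "space circle_measure = sphere 0 1"
  by (simp add: circle_measure_def space_restrict_space)

lemma measurable_power_circle [measurable]: "(\<lambda>z. z ^ N) \<in> circle_measure \<rightarrow>\<^sub>M circle_measure"
proof -
  have "(\<lambda>z::complex. z ^ N) \<in> restrict_space borel (sphere 0 1) \<rightarrow>\<^sub>M restrict_space borel (sphere 0 1)"
    by (rule measurable_restrict_space3) (auto simp: norm_power)
  then show ?thesis
    by (simp add: measurable_cong_sets[OF sets_circle_measure sets_circle_measure])
qed

lemma nn_integral_circle_measure:
  fixes g :: "complex \<Rightarrow> ennreal"
  assumes g: "g \<in> borel_measurable circle_measure"
  shows "(\<integral>\<^sup>+z. g z \<partial>circle_measure) =
    (\<integral>\<^sup>+t. g (cis t) * indicator {0..<2 * pi} t \<partial>lborel) / ennreal (2 * pi)"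
proof -
  have g': "g \<in> borel_measurable (restrict_space borel (sphere 0 1))"
    using g by (simp add: measurable_cong_sets[OF sets_circle_measure refl])
  have [measurable]: "(\<lambda>t. g (cis t)) \<in> borel_measurable borel"
    by (rule measurable_compose[OF measurable_cis_circle g'])
  have "(\<integral>\<^sup>+z. g z \<partial>circle_measure) = (\<integral>\<^sup>+t. g (cis t) \<partial>uniform_measure lborel {0..<2 * pi})"
    unfolding circle_measure_def
    by (rule nn_integral_distr) (use measurable_cis_circle g' in auto)
  also have "\<dots> = (\<integral>\<^sup>+t. g (cis t) * indicator {0..<2 * pi} t \<partial>lborel) / ennreal (2 * pi)"
    by (subst nn_integral_uniform_measure) auto
  finally show ?thesis .
qed

lemma cis_add_period: "cis (2 * pi * real k + t) = cis t"
  by (metis add.commute cis_multiple_2pi cis_mult mult.right_neutral Ints_of_nat)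

lemma nn_integral_circle_power:
  fixes g :: "complex \<Rightarrow> ennreal"
  assumes g: "g \<in> borel_measurable circle_measure" and N: "N > 0"
  shows "(\<integral>\<^sup>+z. g (z ^ N) \<partial>circle_measure) = (\<integral>\<^sup>+z. g z \<partial>circle_measure)"
proof -
  have g': "g \<in> borel_measurable (restrict_space borel (sphere 0 1))"
    using g by (simp add: measurable_cong_sets[OF sets_circle_measure refl])
  have F [measurable]: "(\<lambda>t. g (cis t)) \<in> borel_measurable borel"
    by (rule measurable_compose[OF measurable_cis_circle g'])
  define J where "J k = {2 * pi * real k ..< 2 * pi * real (Suc k)}" for k
  define I where "I = (\<integral>\<^sup>+t. g (cis t) * indicator {0..<2 * pi} t \<partial>lborel)"
  have J_meas [measurable]: "J k \<in> sets borel" for k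
    by (simp add: J_def)
  have shift: "(\<integral>\<^sup>+t. g (cis t) * indicator (J k) t \<partial>lborel) = I" for k
  proof -
    have "(\<integral>\<^sup>+t. g (cis t) * indicator (J k) t \<partial>lborel) =
        \<bar>1::real\<bar> * (\<integral>\<^sup>+t. g (cis (2 * pi * real k + 1 * t)) * indicator (J k) (2 * pi * real k + 1 * t) \<partial>lborel)"
      by (rule nn_integral_real_affine) measurable
    also have "\<dots> = I"
      unfolding I_def
      by (auto simp: cis_add_period J_def distrib_left intro!: nn_integral_cong
          split: split_indicator)
    finally show ?thesis .
  qed
  have ind: "(\<Sum>k<n. indicator (J k) t :: ennreal) = indicator {0..<2 * pi * real n} t" for n t
  proof (induction n)
    case (Suc n)
    have split: "(indicator {0..<a} t + indicator {a..<b} t :: ennreal) = indicator {0..<b} t"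
      if "0 \<le> a" "a \<le> b" for a b
      using that by (auto split: split_indicator)
    have "(indicator {0..<2 * pi * real n} t + indicator (J n) t :: ennreal) =
        indicator {0..<2 * pi * real (Suc n)} t"
      unfolding J_def by (rule split) simp_all
    then show ?case
      using Suc by simp
  qed simp
  have "of_nat N * I = (\<Sum>k<N. \<integral>\<^sup>+t. g (cis t) * indicator (J k) t \<partial>lborel)"
    by (simp add: shift)
  also have "\<dots> = (\<integral>\<^sup>+t. g (cis t) * indicator {0..<2 * pi * real N} t \<partial>lborel)"
    by (subst nn_integral_sum[symmetric]) (auto simp flip: sum_distrib_left simp: ind)
  also have "\<dots> = \<bar>real N\<bar> * (\<integral>\<^sup>+t. g (cis (0 + real N * t)) *
      indicator {0..<2 * pi * real N} (0 + real N * t) \<partial>lborel)"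
    by (rule nn_integral_real_affine) (use N in auto)
  also have "(\<lambda>t. g (cis (0 + real N * t)) * indicator {0..<2 * pi * real N} (0 + real N * t)) =
      (\<lambda>t. g (cis t ^ N) * indicator {0..<2 * pi} t)"
    using N by (auto simp: fun_eq_iff Complex.DeMoivre zero_le_mult_iff mult.commute[of _ "real N"] split: split_indicator)
  finally have "of_nat N * I =
      of_nat N * (\<integral>\<^sup>+t. g (cis t ^ N) * indicator {0..<2 * pi} t \<partial>lborel)"
    by (simp add: ennreal_of_nat_eq_real_of_nat)
  then have eq: "I = (\<integral>\<^sup>+t. g (cis t ^ N) * indicator {0..<2 * pi} t \<partial>lborel)"
    using N by (subst (asm) ennreal_mult_cancel_left) auto
  have "(\<integral>\<^sup>+z. g (z ^ N) \<partial>circle_measure) =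
      (\<integral>\<^sup>+t. g (cis t ^ N) * indicator {0..<2 * pi} t \<partial>lborel) / ennreal (2 * pi)"
    by (rule nn_integral_circle_measure) (rule measurable_compose[OF measurable_power_circle g])
  then show ?thesis
    by (simp only: nn_integral_circle_measure[OF g] eq[symmetric] I_def)
qed

lemma distr_power_circle:
  assumes "N > 0"
  shows "distr circle_measure circle_measure (\<lambda>z. z ^ N) = circle_measure"
proof (rule measure_eqI)
  fix A assume "A \<in> sets (distr circle_measure circle_measure (\<lambda>z. z ^ N))"
  then have A [measurable]: "A \<in> sets circle_measure" by simp
  have "emeasure (distr circle_measure circle_measure (\<lambda>z. z ^ N)) A =
      (\<integral>\<^sup>+z. indicator A z \<partial>distr circle_measure circle_measure (\<lambda>z. z ^ N))"
    by simp
  also have "\<dots> = (\<integral>\<^sup>+z. indicator A (z ^ N) \<partial>circle_measure)"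
    by (rule nn_integral_distr) auto
  also have "\<dots> = (\<integral>\<^sup>+z. indicator A z \<partial>circle_measure)"
    by (rule nn_integral_circle_power) (use assms in auto)
  finally show "emeasure (distr circle_measure circle_measure (\<lambda>z. z ^ N)) A =
      emeasure circle_measure A"
    by simp
qed simp

lemma square_integrable_filter:
  assumes m: "m \<in> Linf_circle" and f: "square_integrable f" and N: "N > 0"
  shows "square_integrable (\<lambda>z. m z * f (z ^ N))"
proof -
  have [measurable]: "m \<in> borel_measurable circle_measure" "f \<in> borel_measurable circle_measure"
    using m f by (auto simp: Linf_circle_def square_integrable_def)
  obtain C where C: "AE z in circle_measure. cmod (m z) \<le> C"
    using m by (auto simp: Linf_circle_def)
  have "integrable (distr circle_measure circle_measure (\<lambda>z. z ^ N)) (\<lambda>z. (cmod (f z))\<^sup>2)"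
    using f N by (simp add: distr_power_circle square_integrable_def)
  then have "integrable circle_measure (\<lambda>z. (cmod (f (z ^ N)))\<^sup>2)"
    by (rule integrable_distr[OF measurable_power_circle])
  then have "integrable circle_measure (\<lambda>z. C\<^sup>2 * (cmod (f (z ^ N)))\<^sup>2)"
    by simp
  moreover have "AE z in circle_measure.
      norm ((cmod (m z * f (z ^ N)))\<^sup>2) \<le> norm (C\<^sup>2 * (cmod (f (z ^ N)))\<^sup>2)"
    using C by eventually_elim
      (auto simp: norm_mult power_mult_distrib intro!: mult_right_mono power_mono)
  moreover have "(\<lambda>z. (cmod (m z * f (z ^ N)))\<^sup>2) \<in> borel_measurable circle_measure"
    by measurable
  ultimately have "integrable circle_measure (\<lambda>z. (cmod (m z * f (z ^ N)))\<^sup>2)"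
    using Bochner_Integration.integrable_bound by blast
  then show ?thesis
    by (simp add: square_integrable_def)
qed

lemma filter_op_abs:
  assumes m: "m \<in> Linf_circle" and f: "square_integrable f" and N: "N > 0"
  shows "filter_op N m (abs_l2_circle f) = abs_l2_circle (\<lambda>z. m z * f (z ^ N))"
proof -
  have "l2_rel (rep_l2_circle (abs_l2_circle f)) f"
    using f by (intro rep_abs_rsp_left[OF Quotient3_l2_circle]) (simp add: l2_rel_def)
  then have r: "square_integrable (rep_l2_circle (abs_l2_circle f))"
    and ae: "AE z in circle_measure. rep_l2_circle (abs_l2_circle f) z = f z"
    by (auto simp: l2_rel_def)
  have "AE z in distr circle_measure circle_measure (\<lambda>z. z ^ N).
      rep_l2_circle (abs_l2_circle f) z = f z"
    using ae by (simp only: distr_power_circle[OF N])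
  then have "AE z in circle_measure. rep_l2_circle (abs_l2_circle f) (z ^ N) = f (z ^ N)"
    by (rule AE_distrD[OF measurable_power_circle])
  then have "l2_rel (\<lambda>z. m z * rep_l2_circle (abs_l2_circle f) (z ^ N)) (\<lambda>z. m z * f (z ^ N))"
    using m f r N by (auto simp: l2_rel_def intro!: square_integrable_filter)
  then show ?thesis
    unfolding filter_op_def by (rule Quotient_rel_abs[OF Quotient_l2_circle])
qed

end

theory Submission
  imports Defs "HOL-Complex_Analysis.Cauchy_Integral_Theorem"
begin

text \<open>
  Everything rests on the averaging operator \<open>E\<close> (\<open>fibre_mean\<close>) that sends \<open>f\<close> to the function whose
  value at \<open>z\<close> is the mean of \<open>f\<close> over the \<open>N\<close> solutions of \<open>w ^ N = z\<close>. It preserves integrals, because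
  the circle measure is invariant under rotations and under \<open>z \<mapsto> z ^ N\<close>, and
  \<open>E (\<lambda>w. g (w ^ N) * f w) = g * E f\<close>. Hence the adjoint of \<open>S\<^sub>i\<close> is \<open>f \<mapsto> E (cnj m\<^sub>i * f)\<close>
  (\<open>l2_adjoint_filter_op\<close>), and composing it with the \<open>j\<close>-th operator of the second family gives
  multiplication by \<open>E (cnj m\<^sub>i * mt\<^sub>j)\<close>.
  
  Let \<open>M z\<close> and \<open>Mt z\<close> be the modulation matrices of \<open>m\<close> and \<open>mt\<close>. The value of
  \<open>E (cnj m\<^sub>i * mt\<^sub>j)\<close> at \<open>z ^ N\<close> is the entry \<open>(j, i)\<close> of \<open>Mt z * (M z)\<^sup>*\<close>. So the first half of (i)
  says that this product is the identity for almost every \<open>z\<close>. The matrices being square, this is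
  the same as \<open>(M z)\<^sup>* * Mt z = 1\<close>, which is (ii)
  (\<open>modulation_biorthogonal_iff_fibre_mean\<close>, \<open>adjoint_inverse_iff\<close>). Row \<open>0\<close> of this last equation is
  exactly what makes the sum in the second half of (i) collapse to \<open>f z\<close>
  (\<open>modulation_resolution_of_identity\<close>); thus the second half of (i) follows from the first.
  
  For (iii), the polyphase matrix at \<open>z ^ N\<close> is \<open>M z * U z\<close> for a unitary matrix \<open>U z\<close> of Fourier type that
  does not depend on the filters. Therefore \<open>A\<^sup>* * At\<close> at \<open>z ^ N\<close> is \<open>(M z)\<^sup>* * Mt z\<close> conjugated by a unitary,
  and one is the identity exactly when the other is (\<open>modulation_biorthogonal_iff_polyphase\<close>).
  
  These identities relate a property of \<open>z\<close> to a property of \<open>z ^ N\<close>; \<open>AE_circle_power_iff\<close> says that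
  two such properties hold almost everywhere simultaneously.
\<close>

section \<open>Fibres of the power map\<close>

definition fibre_mean :: "nat \<Rightarrow> (complex \<Rightarrow> complex) \<Rightarrow> complex \<Rightarrow> complex" where
  "fibre_mean N f z = (\<Sum>w | w ^ N = z. f w) / of_nat N"

abbreviation root_of_unity :: "nat \<Rightarrow> nat \<Rightarrow> complex" where
  "root_of_unity N l \<equiv> cis (2 * pi * real l / real N)"

text \<open>
  The fibres of the power map are the orbits of the group of \<open>N\<close>-th roots of unity; enumerating them by
  \<open>l < N\<close> matches the columns of the modulation matrix.
\<close>
lemma bij_betw_fibre:
  assumes "N > 0" "z \<noteq> 0"
  shows "bij_betw (\<lambda>l. root_of_unity N l * z) {..<N} {w. w ^ N = z ^ N}"
proof -
  have "bij_betw (\<lambda>w. w * z) {w. w ^ N = 1} {w. w ^ N = z ^ N}"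
    by (rule bij_betwI[where g = "\<lambda>w. w / z"])
      (use assms in \<open>auto simp: power_mult_distrib power_divide\<close>)
  from bij_betw_trans[OF Complex.bij_betw_roots_unity[OF assms(1)] this] show ?thesis
    by (simp add: o_def)
qed

lemma sum_fibre:
  assumes "N > 0" "z \<noteq> 0"
  shows "(\<Sum>w | w ^ N = z ^ N. f w) = (\<Sum>l<N. f (root_of_unity N l * z))"
  using sum.reindex_bij_betw[OF bij_betw_fibre[OF assms], of f] by simp

lemma fibre_mean_power:
  assumes "N > 0" "z \<noteq> 0"
  shows "fibre_mean N f (z ^ N) = (\<Sum>l<N. f (root_of_unity N l * z)) / of_nat N"
  unfolding fibre_mean_def by (simp only: sum_fibre[OF assms])

text \<open>
  A function of \<open>w ^ N\<close> is constant on fibres: this module property makes \<open>fibre_mean\<close> the conditional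
  expectation for the power map.
\<close>
lemma fibre_mean_pullback:
  "fibre_mean N (\<lambda>w. g (w ^ N) * f w) z = g z * fibre_mean N f z"
  by (simp add: fibre_mean_def sum_distrib_left)

text \<open>
  A Borel section of the power map. Writing a fibre as the orbit of such a root reduces
  measurability of fibre means, and of properties quantified over fibres, to finite sums and
  conjunctions.
\<close>
definition circle_root :: "nat \<Rightarrow> complex \<Rightarrow> complex" where
  "circle_root N z = exp (Ln z / of_nat N)"

lemma circle_root_power: "N > 0 \<Longrightarrow> z \<noteq> 0 \<Longrightarrow> circle_root N z ^ N = z"
  by (simp add: circle_root_def flip: exp_of_nat_mult)

lemma circle_root_nonzero [simp]: "circle_root N z \<noteq> 0"
  by (simp add: circle_root_def)

lemma measurable_circle_self:
  assumes "f \<in> borel_measurable borel" "\<And>z. cmod z = 1 \<Longrightarrow> cmod (f z) = 1"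
  shows "f \<in> circle_measure \<rightarrow>\<^sub>M circle_measure"
proof -
  have "f \<in> restrict_space borel (sphere 0 1) \<rightarrow>\<^sub>M restrict_space borel (sphere 0 1)"
    by (rule measurable_restrict_space3) (use assms in auto)
  then show ?thesis
    by (simp add: measurable_cong_sets[OF sets_circle_measure sets_circle_measure])
qed

lemma measurable_circle_root [measurable]:
  "circle_root N \<in> circle_measure \<rightarrow>\<^sub>M circle_measure"
proof (rule measurable_circle_self)
  show "circle_root N \<in> borel_measurable borel"
    unfolding circle_root_def by measurable
  show "cmod (circle_root N z) = 1" if "cmod z = 1" for z
  proof -
    have "z \<noteq> 0" using that by auto
    then show ?thesis using that by (simp add: circle_root_def)
  qed
qed

lemma measurable_rotation [measurable]:
  "(\<lambda>z. cis a * z) \<in> circle_measure \<rightarrow>\<^sub>M circle_measure"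
  by (rule measurable_circle_self) (auto simp: norm_mult)

lemma borel_measurable_fibre_mean [measurable]:
  assumes N: "N > 0" and f [measurable]: "f \<in> borel_measurable circle_measure"
  shows "fibre_mean N f \<in> borel_measurable circle_measure"
proof -
  have "(\<lambda>z. (\<Sum>l<N. f (root_of_unity N l * circle_root N z)) / of_nat N)
      \<in> borel_measurable circle_measure"
    by measurable
  moreover have "fibre_mean N f z = (\<Sum>l<N. f (root_of_unity N l * circle_root N z)) / of_nat N"
    if "z \<in> space circle_measure" for z
  proof -
    have "z \<noteq> 0" using that by (auto simp: space_circle_measure)
    then show ?thesis
      using fibre_mean_power[OF N, of "circle_root N z" f] by (simp add: circle_root_power N)
  qed
  ultimately show ?thesis
    by (subst measurable_cong) auto
qed


section \<open>Integration along the fibres\<close>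

text \<open>
  The shifted interval \<open>{a..<2 * pi + a}\<close> is cut at \<open>2 * pi\<close>, and the part beyond is moved back by one
  period.
\<close>
lemma nn_integral_circle_rotation:
  fixes g :: "complex \<Rightarrow> ennreal"
  assumes g: "g \<in> borel_measurable circle_measure" and a: "0 \<le> a" "a \<le> 2 * pi"
  shows "(\<integral>\<^sup>+z. g (cis a * z) \<partial>circle_measure) = (\<integral>\<^sup>+z. g z \<partial>circle_measure)"
proof -
  have g': "g \<in> borel_measurable (restrict_space borel (sphere 0 1))"
    using g by (simp add: measurable_cong_sets[OF sets_circle_measure refl])
  have F [measurable]: "(\<lambda>t. g (cis t)) \<in> borel_measurable borel"
    by (rule measurable_compose[OF measurable_cis_circle g'])
  have shift: "(\<integral>\<^sup>+t. g (cis t) * indicator {b + c..<b + d} t \<partial>lborel) =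
      (\<integral>\<^sup>+t. g (cis (b + t)) * indicator {c..<d} t \<partial>lborel)" for b c d
  proof -
    have "(\<integral>\<^sup>+t. g (cis t) * indicator {b + c..<b + d} t \<partial>lborel) =
      \<bar>1::real\<bar> * (\<integral>\<^sup>+t. g (cis (b + 1 * t)) * indicator {b + c..<b + d} (b + 1 * t) \<partial>lborel)"
      by (rule nn_integral_real_affine) measurable
    then show ?thesis
      by (auto intro!: nn_integral_cong split: split_indicator)
  qed
  have split: "(\<integral>\<^sup>+t. g (cis t) * indicator {b..<d} t \<partial>lborel) =
      (\<integral>\<^sup>+t. g (cis t) * indicator {b..<c} t \<partial>lborel) +
      (\<integral>\<^sup>+t. g (cis t) * indicator {c..<d} t \<partial>lborel)" if "b \<le> c" "c \<le> d" for b c d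
    using that
    by (subst nn_integral_add[symmetric]) (auto intro!: nn_integral_cong split: split_indicator)
  have "(\<integral>\<^sup>+t. g (cis a * cis t) * indicator {0..<2 * pi} t \<partial>lborel) =
      (\<integral>\<^sup>+t. g (cis t) * indicator {a..<2 * pi + a} t \<partial>lborel)"
    using shift[of a 0 "2 * pi"] by (simp add: cis_mult add.commute)
  also have "\<dots> = (\<integral>\<^sup>+t. g (cis t) * indicator {a..<2 * pi} t \<partial>lborel) +
      (\<integral>\<^sup>+t. g (cis t) * indicator {2 * pi + 0..<2 * pi + a} t \<partial>lborel)"
    using split[of a "2 * pi" "2 * pi + a"] a by simp
  also have "(\<integral>\<^sup>+t. g (cis t) * indicator {2 * pi + 0..<2 * pi + a} t \<partial>lborel) =
      (\<integral>\<^sup>+t. g (cis t) * indicator {0..<a} t \<partial>lborel)"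
    unfolding shift using cis_add_period[of 1] by simp
  also have "(\<integral>\<^sup>+t. g (cis t) * indicator {a..<2 * pi} t \<partial>lborel) + \<dots> =
      (\<integral>\<^sup>+t. g (cis t) * indicator {0..<2 * pi} t \<partial>lborel)"
    using split[of 0 a "2 * pi"] a by (simp add: add.commute)
  finally have "(\<integral>\<^sup>+t. g (cis a * cis t) * indicator {0..<2 * pi} t \<partial>lborel) =
      (\<integral>\<^sup>+t. g (cis t) * indicator {0..<2 * pi} t \<partial>lborel)" .
  moreover have "(\<lambda>z. g (cis a * z)) \<in> borel_measurable circle_measure"
    by (rule measurable_compose[OF measurable_rotation g])
  ultimately show ?thesis
    by (simp only: nn_integral_circle_measure[OF g] nn_integral_circle_measure)
qed

lemma distr_rotation_circle:
  assumes "0 \<le> a" "a \<le> 2 * pi"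
  shows "distr circle_measure circle_measure (\<lambda>z. cis a * z) = circle_measure"
proof (rule measure_eqI)
  fix A assume "A \<in> sets (distr circle_measure circle_measure (\<lambda>z. cis a * z))"
  then have A [measurable]: "A \<in> sets circle_measure" by simp
  have "emeasure (distr circle_measure circle_measure (\<lambda>z. cis a * z)) A =
      (\<integral>\<^sup>+z. indicator A z \<partial>distr circle_measure circle_measure (\<lambda>z. cis a * z))"
    by simp
  also have "\<dots> = (\<integral>\<^sup>+z. indicator A (cis a * z) \<partial>circle_measure)"
    by (rule nn_integral_distr) auto
  also have "\<dots> = (\<integral>\<^sup>+z. indicator A z \<partial>circle_measure)"
    by (rule nn_integral_circle_rotation) (use assms in auto)
  finally show "emeasure (distr circle_measure circle_measure (\<lambda>z. cis a * z)) A =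
      emeasure circle_measure A"
    by simp
qed simp

lemma distr_root_of_unity:
  assumes "l < N"
  shows "distr circle_measure circle_measure (\<lambda>z. root_of_unity N l * z) = circle_measure"
proof (rule distr_rotation_circle)
  have "2 * pi * real l \<le> 2 * pi * real N"
    using assms by (intro mult_left_mono) auto
  then show "2 * pi * real l / real N \<le> 2 * pi"
    using assms by (simp add: field_simps)
qed auto

text \<open>
  The integrals of \<open>fibre_mean N f\<close> and of its pullback along the power map agree. The pullback is
  the average of \<open>N\<close> rotations of \<open>f\<close>, each with the same integral as \<open>f\<close>.
\<close>
lemma integral_fibre_mean:
  assumes N: "N > 0" and f: "integrable circle_measure f"
  shows "(\<integral>z. fibre_mean N f z \<partial>circle_measure) = (\<integral>z. f z \<partial>circle_measure)"
proof -
  have [measurable]: "f \<in> borel_measurable circle_measure"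
    using f by simp
  have rot: "integrable circle_measure (\<lambda>z. f (root_of_unity N l * z))"
    "(\<integral>z. f (root_of_unity N l * z) \<partial>circle_measure) = (\<integral>z. f z \<partial>circle_measure)"
    if "l < N" for l
  proof -
    have d: "distr circle_measure circle_measure (\<lambda>z. root_of_unity N l * z) = circle_measure"
      using that by (rule distr_root_of_unity)
    show "integrable circle_measure (\<lambda>z. f (root_of_unity N l * z))"
      by (rule integrable_distr[where M' = circle_measure]) (simp_all add: d f)
    show "(\<integral>z. f (root_of_unity N l * z) \<partial>circle_measure) = (\<integral>z. f z \<partial>circle_measure)"
      by (subst (2) d[symmetric], subst integral_distr) simp_all
  qed
  have "(\<integral>z. fibre_mean N f z \<partial>circle_measure) = (\<integral>z. fibre_mean N f (z ^ N) \<partial>circle_measure)"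
    by (subst distr_power_circle[OF N, symmetric], subst integral_distr) (simp_all add: N)
  also have "\<dots> = (\<integral>z. (\<Sum>l<N. f (root_of_unity N l * z)) / of_nat N \<partial>circle_measure)"
    by (rule Bochner_Integration.integral_cong)
      (auto simp: space_circle_measure intro!: fibre_mean_power N)
  also have "\<dots> = (\<integral>z. f z \<partial>circle_measure)"
    using N rot by (simp add: Bochner_Integration.integral_sum)
  finally show ?thesis .
qed

lemma square_integrable_sum:
  assumes "finite I" "\<And>i. i \<in> I \<Longrightarrow> square_integrable (f i)"
  shows "square_integrable (\<lambda>z. \<Sum>i\<in>I. f i z)"
  using assms by (induction I rule: finite_induct)
    (auto intro: square_integrable_zero square_integrable_add)

text \<open>
  As for the integral, it suffices to treat the pullback along the power map, which is a finite sum of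
  rotations of \<open>f\<close>.
\<close>
lemma square_integrable_fibre_mean:
  assumes N: "N > 0" and f: "square_integrable f"
  shows "square_integrable (fibre_mean N f)"
proof -
  have [measurable]: "f \<in> borel_measurable circle_measure"
    using f by (simp add: square_integrable_def)
  have rot: "square_integrable (\<lambda>z. f (root_of_unity N l * z))" if "l < N" for l
  proof -
    have d: "distr circle_measure circle_measure (\<lambda>z. root_of_unity N l * z) = circle_measure"
      using that by (rule distr_root_of_unity)
    have "integrable circle_measure (\<lambda>z. (cmod (f (root_of_unity N l * z)))\<^sup>2)"
      by (rule integrable_distr[where M' = circle_measure])
        (use f in \<open>simp_all add: d square_integrable_def\<close>)
    then show ?thesis
      by (simp add: square_integrable_def)
  qed
  have "square_integrable (\<lambda>z. \<Sum>l<N. f (root_of_unity N l * z))"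
    by (rule square_integrable_sum) (use rot in auto)
  then have "integrable circle_measure (\<lambda>z. (cmod (\<Sum>l<N. f (root_of_unity N l * z)))\<^sup>2 / (real N)\<^sup>2)"
    by (simp add: square_integrable_def)
  moreover have "(cmod (\<Sum>l<N. f (root_of_unity N l * z)))\<^sup>2 / (real N)\<^sup>2 = (cmod (fibre_mean N f (z ^ N)))\<^sup>2"
    if "z \<in> space circle_measure" for z
  proof -
    have "z \<noteq> 0" using that by (auto simp: space_circle_measure)
    then show ?thesis
      by (simp add: fibre_mean_power N norm_divide power_divide)
  qed
  ultimately have "integrable circle_measure (\<lambda>z. (cmod (fibre_mean N f (z ^ N)))\<^sup>2)"
    by (simp cong: Bochner_Integration.integrable_cong)
  then have "integrable (distr circle_measure circle_measure (\<lambda>z. z ^ N)) (\<lambda>z. (cmod (fibre_mean N f z))\<^sup>2)"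
    by (subst integrable_distr_eq) (simp_all add: N)
  then show ?thesis
    by (simp add: distr_power_circle N square_integrable_def)
qed

lemma AE_circle_power:
  assumes "N > 0" "AE z in circle_measure. P z"
  shows "AE z in circle_measure. P (z ^ N)"
proof -
  have "AE z in distr circle_measure circle_measure (\<lambda>z. z ^ N). P z"
    using assms by (simp only: distr_power_circle)
  then show ?thesis
    by (rule AE_distrD[OF measurable_power_circle])
qed

text \<open>
  Null sets push forward to null sets along the power map: if \<open>P\<close> fails only on a null set \<open>Z\<close>, then the
  union of the \<open>N\<close> rotations of \<open>Z\<close> is null, and it is the preimage of the set of points whose fibre meets \<open>Z\<close>.
\<close>
lemma AE_circle_fibre:
  assumes N: "N > 0" and P: "AE z in circle_measure. P z"
  shows "AE z in circle_measure. \<forall>w. w ^ N = z \<longrightarrow> P w"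
proof -
  obtain Z where Z: "Z \<in> null_sets circle_measure" "{z \<in> space circle_measure. \<not> P z} \<subseteq> Z"
    using P by (auto simp: eventually_ae_filter)
  have [measurable]: "Z \<in> sets circle_measure"
    using Z by auto
  \<comment> \<open>The section \<open>circle_root\<close> turns the quantifier over the fibre into a finite one, so that \<open>Q\<close> is
    measurable and can be transported along the power map.\<close>
  define Q where "Q z \<longleftrightarrow> (\<forall>l<N. root_of_unity N l * circle_root N z \<notin> Z)" for z
  have fib: "Q (z ^ N) \<longleftrightarrow> (\<forall>w. w ^ N = z ^ N \<longrightarrow> w \<notin> Z)" if "z \<noteq> 0" for z
  proof -
    have "z ^ N \<noteq> 0" using that by simp
    then have "{w. w ^ N = z ^ N} = (\<lambda>l. root_of_unity N l * circle_root N (z ^ N)) ` {..<N}"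
      using bij_betw_fibre[OF N, of "circle_root N (z ^ N)"]
      by (simp add: bij_betw_def circle_root_power N)
    then have "(\<forall>w\<in>{w. w ^ N = z ^ N}. w \<notin> Z) \<longleftrightarrow>
        (\<forall>l\<in>{..<N}. root_of_unity N l * circle_root N (z ^ N) \<notin> Z)"
      by simp
    then show ?thesis
      unfolding Q_def by (simp only: mem_Collect_eq Ball_def lessThan_iff)
  qed
  have "AE z in circle_measure. root_of_unity N l * z \<notin> Z" if "l < N" for l
  proof -
    have "AE z in distr circle_measure circle_measure (\<lambda>z. root_of_unity N l * z). z \<notin> Z"
      using Z by (simp add: distr_root_of_unity that AE_not_in)
    then show ?thesis
      by (rule AE_distrD[rotated]) measurable
  qed
  then have "AE z in circle_measure. \<forall>l\<in>{..<N}. root_of_unity N l * z \<notin> Z"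
    by (subst AE_finite_all) auto
  moreover have "AE z in circle_measure. z \<noteq> 0"
    by (rule AE_I2) (auto simp: space_circle_measure)
  ultimately have "AE z in circle_measure. Q (z ^ N)"
  proof eventually_elim
    case (elim z)
    have "w \<notin> Z" if "w ^ N = z ^ N" for w
    proof -
      have "w \<in> (\<lambda>l. root_of_unity N l * z) ` {..<N}"
        using that bij_betw_fibre[OF N elim(2)] by (simp add: bij_betw_def)
      then show ?thesis using elim(1) by auto
    qed
    then show ?case using fib[OF elim(2)] by blast
  qed
  then have "AE z in distr circle_measure circle_measure (\<lambda>z. z ^ N). Q z"
    by (subst AE_distr_iff) (auto simp: Q_def)
  then have "AE z in circle_measure. Q z"
    by (simp only: distr_power_circle[OF N])
  then show ?thesis
  proof (rule AE_mp, intro AE_I2 impI allI)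
    fix z w assume z: "z \<in> space circle_measure" "Q z" and w: "w ^ N = z"
    have 1: "cmod w = 1"
      using z w N power_eq_imp_eq_base[of "cmod w" N 1]
      by (auto simp: space_circle_measure norm_power)
    then have "w \<noteq> 0"
      by auto
    then have "w \<notin> Z"
      using fib z(2) w by metis
    then show "P w"
      using Z(2) 1 by (auto simp: space_circle_measure)
  qed
qed


text \<open>
  The device by which conditions on the modulation matrix at \<open>z\<close> are compared with conditions at the
  point \<open>z ^ N\<close>.
\<close>
lemma AE_circle_power_iff:
  assumes N: "N > 0" and PQ: "\<And>z. cmod z = 1 \<Longrightarrow> P z \<longleftrightarrow> Q (z ^ N)"
  shows "(AE z in circle_measure. P z) \<longleftrightarrow> (AE z in circle_measure. Q z)"
proof
  assume "AE z in circle_measure. P z"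
  from AE_circle_fibre[OF N this] show "AE z in circle_measure. Q z"
  proof (rule AE_mp, intro AE_I2 impI)
    fix z assume z: "z \<in> space circle_measure" and P: "\<forall>w. w ^ N = z \<longrightarrow> P w"
    have "circle_root N z \<in> space circle_measure"
      by (rule measurable_space[OF measurable_circle_root z])
    then have "cmod (circle_root N z) = 1"
      by (simp add: space_circle_measure)
    moreover have "circle_root N z ^ N = z"
      using z by (auto simp: space_circle_measure intro!: circle_root_power N)
    ultimately show "Q z"
      using P PQ by metis
  qed
next
  assume "AE z in circle_measure. Q z"
  from AE_circle_power[OF N this] show "AE z in circle_measure. P z"
    by (rule AE_mp) (auto intro!: AE_I2 simp: space_circle_measure PQ)
qed


section \<open>The Hilbert space of the circle\<close>

lemma l2_circle_cases:
  obtains f where "square_integrable f" "x = abs_l2_circle f"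
proof
  show "x = abs_l2_circle (rep_l2_circle x)"
    by (simp add: Quotient3_abs_rep[OF Quotient3_l2_circle])
  show "square_integrable (rep_l2_circle x)"
    using Quotient3_rep_reflp[OF Quotient3_l2_circle, of x] by (simp add: l2_rel_def)
qed

lemma abs_l2_circle_eq_iff:
  assumes "square_integrable f" "square_integrable g"
  shows "abs_l2_circle f = abs_l2_circle g \<longleftrightarrow> (AE z in circle_measure. f z = g z)"
  using Quotient3_rel[OF Quotient3_l2_circle, of f g] assms by (simp add: l2_rel_def)

lemma l2_inner_abs:
  assumes "square_integrable f" "square_integrable g"
  shows "l2_inner (abs_l2_circle f) (abs_l2_circle g) = (\<integral>z. f z * cnj (g z) \<partial>circle_measure)"
  by (rule l2_inner.abs_eq) (use assms in \<open>auto simp: l2_rel_def\<close>)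

lemma borel_measurable_cnj [measurable]: "cnj \<in> borel_measurable borel"
  by (intro borel_measurable_continuous_onI continuous_intros)

lemma square_integrable_product:
  assumes "square_integrable f" "square_integrable g"
  shows "integrable circle_measure (\<lambda>z. f z * cnj (g z))"
proof -
  have [measurable]: "f \<in> borel_measurable circle_measure" "g \<in> borel_measurable circle_measure"
    using assms by (auto simp: square_integrable_def)
  have "integrable circle_measure (\<lambda>z. (cmod (f z))\<^sup>2 + (cmod (g z))\<^sup>2)"
    using assms by (auto simp: square_integrable_def)
  then show ?thesis
  proof (rule Bochner_Integration.integrable_bound, measurable, intro AE_I2)
    fix z
    show "norm (f z * cnj (g z)) \<le> norm ((cmod (f z))\<^sup>2 + (cmod (g z))\<^sup>2)"
    proof -
      have "0 \<le> cmod (f z) * cmod (g z)"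
        by simp
      then have "cmod (f z) * cmod (g z) \<le> (cmod (f z))\<^sup>2 + (cmod (g z))\<^sup>2"
        using sum_squares_bound[of "cmod (f z)" "cmod (g z)"] by linarith
      then show ?thesis
        by (simp add: norm_mult)
    qed
  qed
qed

lemma l2_inner_diff_right: "l2_inner f (g - h) = l2_inner f g - l2_inner f h"
proof -
  obtain f' where f: "square_integrable f'" "f = abs_l2_circle f'" by (rule l2_circle_cases)
  obtain g' where g: "square_integrable g'" "g = abs_l2_circle g'" by (rule l2_circle_cases)
  obtain h' where h: "square_integrable h'" "h = abs_l2_circle h'" by (rule l2_circle_cases)
  have "g - h = abs_l2_circle (\<lambda>z. g' z - h' z)"
    unfolding g h by (rule minus_l2_circle.abs_eq) (use g h in \<open>auto simp: l2_rel_def\<close>)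
  then show ?thesis
    using f g h square_integrable_product[OF f(1) g(1)] square_integrable_product[OF f(1) h(1)]
    by (simp add: l2_inner_abs square_integrable_diff right_diff_distrib)
qed

lemma l2_inner_definite:
  assumes "l2_inner f f = 0"
  shows "f = 0"
proof -
  obtain f' where f: "square_integrable f'" "f = abs_l2_circle f'" by (rule l2_circle_cases)
  have int: "integrable circle_measure (\<lambda>z. (cmod (f' z))\<^sup>2)"
    using f by (simp add: square_integrable_def)
  have "complex_of_real (\<integral>z. (cmod (f' z))\<^sup>2 \<partial>circle_measure) = l2_inner f f"
    unfolding f(2) l2_inner_abs[OF f(1) f(1)] complex_norm_square[symmetric]
    by (rule integral_complex_of_real[symmetric])
  then have "AE z in circle_measure. (cmod (f' z))\<^sup>2 = 0"
    using assms integral_nonneg_eq_0_iff_AE[OF int] by simp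
  then have "AE z in circle_measure. f' z = 0"
    by simp
  then show ?thesis
    using f abs_l2_circle_eq_iff[OF f(1) square_integrable_zero]
    by (simp add: zero_l2_circle.abs_eq)
qed

text \<open>
  Definiteness of the inner product makes the adjoint unique, so any operator with the adjoint
  property is the one chosen by the definite description.
\<close>
lemma l2_adjoint_eqI:
  assumes "\<And>f g. l2_inner (S f) g = l2_inner f (T g)"
  shows "l2_adjoint S = T"
  unfolding l2_adjoint_def
proof (rule the_equality)
  show "\<forall>f g. l2_inner (S f) g = l2_inner f (T g)"
    using assms by blast
  fix T' assume T': "\<forall>f g. l2_inner (S f) g = l2_inner f (T' g)"
  show "T' = T"
  proof
    fix g
    have "l2_inner f (T' g - T g) = 0" for f
      using T' assms[of f g] by (simp add: l2_inner_diff_right)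
    then have "T' g - T g = 0"
      by (rule l2_inner_definite)
    then show "T' g = T g"
      by simp
  qed
qed

lemma square_integrable_one: "square_integrable (\<lambda>_. 1)"
proof -
  have "emeasure circle_measure (space circle_measure) = (\<integral>\<^sup>+z. 1 \<partial>circle_measure)"
    by simp
  also have "\<dots> < \<infinity>"
    by (subst nn_integral_circle_measure) (auto simp: ennreal_divide_eq_top_iff less_top[symmetric])
  finally have "finite_measure circle_measure"
    by (intro finite_measureI) auto
  then show ?thesis
    by (simp add: square_integrable_def finite_measure.integrable_const)
qed

lemma sum_abs_l2_circle:
  assumes "finite I" "\<And>i. i \<in> I \<Longrightarrow> square_integrable (f i)"
  shows "(\<Sum>i\<in>I. abs_l2_circle (f i)) = abs_l2_circle (\<lambda>z. \<Sum>i\<in>I. f i z)"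
  using assms
proof (induction I rule: finite_induct)
  case empty
  show ?case by (simp add: zero_l2_circle.abs_eq)
next
  case (insert i I)
  have "abs_l2_circle (f i) + abs_l2_circle (\<lambda>z. \<Sum>i\<in>I. f i z) =
      abs_l2_circle (\<lambda>z. f i z + (\<Sum>i\<in>I. f i z))"
    by (rule plus_l2_circle.abs_eq)
      (use insert in \<open>auto simp: l2_rel_def intro!: square_integrable_sum\<close>)
  then show ?case
    using insert by simp
qed


section \<open>Filter operators and their adjoints\<close>

lemma square_integrable_cnj_mult:
  assumes m: "m \<in> Linf_circle" and f: "square_integrable f"
  shows "square_integrable (\<lambda>z. cnj (m z) * f z)"
proof -
  have "(\<lambda>z. cnj (m z)) \<in> Linf_circle"
    using m by (auto simp: Linf_circle_def)
  from square_integrable_filter[OF this f, of 1] show ?thesis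
    by simp
qed

text \<open>
  Since \<open>fibre_mean\<close> preserves the integral of \<open>m z * f (z ^ N) * cnj (g z)\<close>, the factor
  depending on \<open>z ^ N\<close> can be pulled out of the mean, which leaves the inner product of \<open>f\<close> with the
  fibre mean of \<open>cnj m * g\<close>.
\<close>
lemma l2_adjoint_filter_op:
  assumes N: "N > 0" and m: "m \<in> Linf_circle" and f: "square_integrable f"
  shows "l2_adjoint (filter_op N m) (abs_l2_circle f) =
    abs_l2_circle (fibre_mean N (\<lambda>w. cnj (m w) * f w))"
proof -
  \<comment> \<open>An operator on classes needs a representative; \<open>T_abs\<close> then shows that the choice does not matter.\<close>
  define T where "T g = abs_l2_circle (fibre_mean N (\<lambda>w. cnj (m w) * rep_l2_circle g w))" for g
  have T_abs: "T (abs_l2_circle g) = abs_l2_circle (fibre_mean N (\<lambda>w. cnj (m w) * g w))"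
    if g: "square_integrable g" for g
  proof -
    have "l2_rel (rep_l2_circle (abs_l2_circle g)) g"
      using g by (intro rep_abs_rsp_left[OF Quotient3_l2_circle]) (simp add: l2_rel_def)
    then have r: "square_integrable (rep_l2_circle (abs_l2_circle g))"
      and ae: "AE z in circle_measure. rep_l2_circle (abs_l2_circle g) z = g z"
      by (auto simp: l2_rel_def)
    from AE_circle_fibre[OF N ae]
    have "AE z in circle_measure. fibre_mean N (\<lambda>w. cnj (m w) * rep_l2_circle (abs_l2_circle g) w) z =
        fibre_mean N (\<lambda>w. cnj (m w) * g w) z"
      by eventually_elim (auto simp: fibre_mean_def intro!: sum.cong)
    then show ?thesis
      unfolding T_def
      by (subst abs_l2_circle_eq_iff)
        (auto intro!: square_integrable_fibre_mean square_integrable_cnj_mult N m r g)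
  qed
  have "l2_inner (filter_op N m f) g = l2_inner f (T g)" for f g
  proof -
    obtain f' where f: "square_integrable f'" "f = abs_l2_circle f'" by (rule l2_circle_cases)
    obtain g' where g: "square_integrable g'" "g = abs_l2_circle g'" by (rule l2_circle_cases)
    have sf: "square_integrable (\<lambda>z. m z * f' (z ^ N))"
      by (rule square_integrable_filter) (use m f N in auto)
    have "l2_inner (filter_op N m f) g = (\<integral>z. m z * f' (z ^ N) * cnj (g' z) \<partial>circle_measure)"
      using f g sf m N by (simp add: filter_op_abs l2_inner_abs)
    also have "\<dots> = (\<integral>z. fibre_mean N (\<lambda>w. m w * f' (w ^ N) * cnj (g' w)) z \<partial>circle_measure)"
      by (rule integral_fibre_mean[symmetric]) (use N square_integrable_product[OF sf g(1)] in auto)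
    also have "(\<lambda>z. fibre_mean N (\<lambda>w. m w * f' (w ^ N) * cnj (g' w)) z) =
        (\<lambda>z. f' z * cnj (fibre_mean N (\<lambda>w. cnj (m w) * g' w) z))"
      using fibre_mean_pullback[of N f' "\<lambda>w. m w * cnj (g' w)"]
      by (simp add: fun_eq_iff fibre_mean_def mult_ac)
    also have "(\<integral>z. f' z * cnj (fibre_mean N (\<lambda>w. cnj (m w) * g' w) z) \<partial>circle_measure) = l2_inner f (T g)"
      using f g m N
      by (simp add: T_abs l2_inner_abs square_integrable_fibre_mean square_integrable_cnj_mult)
    finally show ?thesis .
  qed
  then have "l2_adjoint (filter_op N m) = T"
    by (rule l2_adjoint_eqI)
  then show ?thesis
    by (simp add: T_abs f)
qed

text \<open>
  The inner operator introduces the factor \<open>f (w ^ N)\<close>, which is constant on fibres; so the composite is a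
  multiplication operator.
\<close>
lemma l2_adjoint_filter_op_filter_op:
  assumes N: "N > 0" and m: "m \<in> Linf_circle" and mt: "mt \<in> Linf_circle"
    and f: "square_integrable f"
  shows "square_integrable (\<lambda>z. f z * fibre_mean N (\<lambda>w. cnj (m w) * mt w) z)"
    and "l2_adjoint (filter_op N m) (filter_op N mt (abs_l2_circle f)) =
      abs_l2_circle (\<lambda>z. f z * fibre_mean N (\<lambda>w. cnj (m w) * mt w) z)"
proof -
  have sf: "square_integrable (\<lambda>z. mt z * f (z ^ N))"
    by (rule square_integrable_filter[OF mt f N])
  have eq: "fibre_mean N (\<lambda>w. cnj (m w) * (mt w * f (w ^ N))) =
      (\<lambda>z. f z * fibre_mean N (\<lambda>w. cnj (m w) * mt w) z)"
    using fibre_mean_pullback[of N f "\<lambda>w. cnj (m w) * mt w"] by (simp add: fun_eq_iff mult_ac)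
  show "square_integrable (\<lambda>z. f z * fibre_mean N (\<lambda>w. cnj (m w) * mt w) z)"
    using square_integrable_fibre_mean[OF N square_integrable_cnj_mult[OF m sf]]
    by (simp only: eq)
  show "l2_adjoint (filter_op N m) (filter_op N mt (abs_l2_circle f)) =
      abs_l2_circle (\<lambda>z. f z * fibre_mean N (\<lambda>w. cnj (m w) * mt w) z)"
    by (simp only: filter_op_abs[OF mt f N] l2_adjoint_filter_op[OF N m sf] eq)
qed

text \<open>
  A multiplication operator determines its symbol up to a null set, as its value at the constant
  function \<open>1\<close>. The Boolean \<open>b\<close> stands for \<open>i = j\<close>.
\<close>
lemma l2_adjoint_filter_op_filter_op_eq_iff:
  assumes N: "N > 0" and m: "m \<in> Linf_circle" and mt: "mt \<in> Linf_circle"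
  shows "l2_adjoint (filter_op N m) \<circ> filter_op N mt = (if b then id else (\<lambda>_. 0)) \<longleftrightarrow>
    (AE z in circle_measure. fibre_mean N (\<lambda>w. cnj (m w) * mt w) z = of_bool b)"
proof -
  have scalar: "(if b then id else (\<lambda>_. 0)) (abs_l2_circle f) = abs_l2_circle (\<lambda>z. f z * of_bool b)" for f
    by (simp add: zero_l2_circle.abs_eq)
  have sq: "square_integrable (\<lambda>z. f z * of_bool b)" if "square_integrable f" for f
    using that by (cases b) (auto simp: square_integrable_zero)
  note comp = l2_adjoint_filter_op_filter_op[OF N m mt]
  show ?thesis
  proof
    assume "l2_adjoint (filter_op N m) \<circ> filter_op N mt = (if b then id else (\<lambda>_. 0))"
    then have "l2_adjoint (filter_op N m) (filter_op N mt (abs_l2_circle (\<lambda>_. 1))) =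
        abs_l2_circle (\<lambda>z. 1 * of_bool b)"
      by (simp only: fun_eq_iff comp_apply scalar)
    then show "AE z in circle_measure. fibre_mean N (\<lambda>w. cnj (m w) * mt w) z = of_bool b"
      using comp[OF square_integrable_one] sq[OF square_integrable_one]
      by (simp add: abs_l2_circle_eq_iff)
  next
    assume ae: "AE z in circle_measure. fibre_mean N (\<lambda>w. cnj (m w) * mt w) z = of_bool b"
    show "l2_adjoint (filter_op N m) \<circ> filter_op N mt = (if b then id else (\<lambda>_. 0))"
    proof
      fix x
      obtain f where f: "square_integrable f" "x = abs_l2_circle f" by (rule l2_circle_cases)
      have "abs_l2_circle (\<lambda>z. f z * fibre_mean N (\<lambda>w. cnj (m w) * mt w) z) =
          abs_l2_circle (\<lambda>z. f z * of_bool b)"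
        using ae comp(1)[OF f(1)] sq[OF f(1)] by (auto simp: abs_l2_circle_eq_iff)
      then show "(l2_adjoint (filter_op N m) \<circ> filter_op N mt) x = (if b then id else (\<lambda>_. 0)) x"
        by (simp only: comp_apply f(2) comp(2)[OF f(1)] scalar)
    qed
  qed
qed

lemma sum_filter_op_l2_adjoint:
  assumes N: "N > 0" and m: "\<And>i. i < N \<Longrightarrow> m i \<in> Linf_circle"
    and mt: "\<And>i. i < N \<Longrightarrow> mt i \<in> Linf_circle" and f: "square_integrable f"
  shows "square_integrable (\<lambda>z. \<Sum>i<N. m i z * fibre_mean N (\<lambda>w. cnj (mt i w) * f w) (z ^ N))"
    and "(\<Sum>i<N. filter_op N (m i) (l2_adjoint (filter_op N (mt i)) (abs_l2_circle f))) =
      abs_l2_circle (\<lambda>z. \<Sum>i<N. m i z * fibre_mean N (\<lambda>w. cnj (mt i w) * f w) (z ^ N))"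
proof -
  have a: "square_integrable (fibre_mean N (\<lambda>w. cnj (mt i w) * f w))" if "i < N" for i
    by (intro square_integrable_fibre_mean square_integrable_cnj_mult N mt f that)
  have b: "square_integrable (\<lambda>z. m i z * fibre_mean N (\<lambda>w. cnj (mt i w) * f w) (z ^ N))"
    if "i < N" for i
    by (rule square_integrable_filter[OF m[OF that] a[OF that] N])
  show "square_integrable (\<lambda>z. \<Sum>i<N. m i z * fibre_mean N (\<lambda>w. cnj (mt i w) * f w) (z ^ N))"
    by (rule square_integrable_sum) (auto intro: b)
  have "(\<Sum>i<N. filter_op N (m i) (l2_adjoint (filter_op N (mt i)) (abs_l2_circle f))) =
      (\<Sum>i<N. abs_l2_circle (\<lambda>z. m i z * fibre_mean N (\<lambda>w. cnj (mt i w) * f w) (z ^ N)))"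
    by (rule sum.cong) (simp_all add: l2_adjoint_filter_op filter_op_abs N m mt f a)
  also have "\<dots> = abs_l2_circle (\<lambda>z. \<Sum>i<N. m i z * fibre_mean N (\<lambda>w. cnj (mt i w) * f w) (z ^ N))"
    by (rule sum_abs_l2_circle) (auto intro: b)
  finally show "(\<Sum>i<N. filter_op N (m i) (l2_adjoint (filter_op N (mt i)) (abs_l2_circle f))) =
      abs_l2_circle (\<lambda>z. \<Sum>i<N. m i z * fibre_mean N (\<lambda>w. cnj (mt i w) * f w) (z ^ N))" .
qed


section \<open>The matrix conditions at a point\<close>

lemma mat_adjoint_carrier [simp]: "A \<in> carrier_mat n k \<Longrightarrow> mat_adjoint A \<in> carrier_mat k n"
  by (auto simp: mat_adjoint_def)

lemma dim_mat_adjoint [simp]: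
  "dim_row (mat_adjoint A) = dim_col A" "dim_col (mat_adjoint A) = dim_row A"
  by (simp_all add: mat_adjoint_def)

lemma index_mat_adjoint [simp]:
  "i < dim_col A \<Longrightarrow> j < dim_row A \<Longrightarrow> mat_adjoint A $$ (i, j) = conjugate (A $$ (j, i))"
  by (simp add: mat_adjoint_def mat_of_rows_def)

lemma mat_adjoint_involutive: "mat_adjoint (mat_adjoint A) = A"
  by (rule eq_matI) auto

lemma mat_adjoint_mult:
  fixes A B :: "complex mat"
  assumes A: "A \<in> carrier_mat n k" and B: "B \<in> carrier_mat k l"
  shows "mat_adjoint (A * B) = mat_adjoint B * mat_adjoint A"
  using A B by (intro eq_matI) (auto simp: scalar_prod_def mult.commute)

lemma mat_adjoint_one: "mat_adjoint (1\<^sub>m n) = (1\<^sub>m n :: complex mat)"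
  by (rule eq_matI) auto

lemma index_mat_adjoint_mult:
  fixes A B :: "complex mat"
  assumes "A \<in> carrier_mat n n" "B \<in> carrier_mat n n" "i < n" "j < n"
  shows "(mat_adjoint A * B) $$ (i, j) = (\<Sum>k<n. cnj (A $$ (k, i)) * B $$ (k, j))"
  using assms by (auto simp: scalar_prod_def lessThan_atLeast0 intro!: sum.cong)

lemma index_mult_mat_adjoint:
  fixes A B :: "complex mat"
  assumes "A \<in> carrier_mat n n" "B \<in> carrier_mat n n" "i < n" "j < n"
  shows "(A * mat_adjoint B) $$ (i, j) = (\<Sum>k<n. A $$ (i, k) * cnj (B $$ (j, k)))"
  using assms by (auto simp: scalar_prod_def lessThan_atLeast0 intro!: sum.cong)

lemma eq_one_mat_iff:
  assumes "A \<in> carrier_mat n n"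
  shows "A = 1\<^sub>m n \<longleftrightarrow> (\<forall>i<n. \<forall>j<n. A $$ (i, j) = (if i = j then 1 else 0))"
  using assms by (auto intro!: eq_matI)

text \<open>
  One-sided inverses of square matrices are two-sided. This is what makes orthogonality relations
  between rows (which the operators see) equivalent to those between columns (which give the resolution of the
  identity).
\<close>
lemma mat_adjoint_mult_eq_one_iff:
  fixes A B :: "complex mat"
  assumes "A \<in> carrier_mat n n" "B \<in> carrier_mat n n"
  shows "mat_adjoint A * B = 1\<^sub>m n \<longleftrightarrow> B * mat_adjoint A = 1\<^sub>m n"
  using assms by (meson mat_adjoint_carrier mat_mult_left_right_inverse)

lemma adjoint_inverse_iff:
  fixes A B :: "complex mat"
  assumes A: "A \<in> carrier_mat n n" and B: "B \<in> carrier_mat n n"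
  shows "invertible_mat A \<and> invertible_mat B \<and> inverts_mat (mat_adjoint A) B \<and>
      inverts_mat B (mat_adjoint A) \<longleftrightarrow> mat_adjoint A * B = 1\<^sub>m n"
proof
  assume AB: "mat_adjoint A * B = 1\<^sub>m n"
  then have BA: "B * mat_adjoint A = 1\<^sub>m n"
    using mat_adjoint_mult_eq_one_iff[OF A B] by simp
  have "mat_adjoint B * A = mat_adjoint (mat_adjoint A * B)"
    using A B by (simp add: mat_adjoint_mult[of _ n n _ n] mat_adjoint_involutive)
  then have BA': "mat_adjoint B * A = 1\<^sub>m n"
    by (simp add: AB mat_adjoint_one)
  then have AB': "A * mat_adjoint B = 1\<^sub>m n"
    using mat_adjoint_mult_eq_one_iff[OF B A] by simp
  show "invertible_mat A \<and> invertible_mat B \<and> inverts_mat (mat_adjoint A) B \<and>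
      inverts_mat B (mat_adjoint A)"
    using A B AB BA AB' BA' by (auto simp: invertible_mat_def inverts_mat_def square_mat.simps)
qed (use A in \<open>auto simp: inverts_mat_def\<close>)

lemma modulation_matrix_carrier [simp]: "modulation_matrix N m z \<in> carrier_mat N N"
  by (simp add: modulation_matrix_def)

lemma index_modulation_matrix:
  assumes "k < N" "l < N"
  shows "modulation_matrix N m z $$ (k, l) = m k (root_of_unity N l * z) / complex_of_real (sqrt (real N))"
proof -
  have "exp (\<i> * 2 * pi * of_nat l / of_nat N) = root_of_unity N l"
    by (simp add: cis_conv_exp mult_ac)
  then show ?thesis
    using assms by (simp add: modulation_matrix_def)
qed

lemma complex_sqrt_mult_self: "complex_of_real (sqrt (real N)) * complex_of_real (sqrt (real N)) = of_nat N"
  by (simp flip: of_real_mult)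

text \<open>
  The sum over the columns of the modulation matrix is a sum over the fibre of \<open>z ^ N\<close>.
\<close>
lemma modulation_matrix_mult_adjoint:
  assumes N: "N > 0" and z: "z \<noteq> 0" and ij: "i < N" "j < N"
  shows "(modulation_matrix N mt z * mat_adjoint (modulation_matrix N m z)) $$ (j, i) =
    fibre_mean N (\<lambda>w. cnj (m i w) * mt j w) (z ^ N)"
  by (simp add: index_mult_mat_adjoint[OF modulation_matrix_carrier modulation_matrix_carrier] ij
      index_modulation_matrix fibre_mean_power[OF N z] complex_sqrt_mult_self sum_divide_distrib mult.commute)

lemma modulation_biorthogonal_iff_fibre_mean:
  assumes N: "N > 0" and z: "z \<noteq> 0"
  shows "mat_adjoint (modulation_matrix N m z) * modulation_matrix N mt z = 1\<^sub>m N \<longleftrightarrow>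
    (\<forall>i<N. \<forall>j<N. fibre_mean N (\<lambda>w. cnj (m i w) * mt j w) (z ^ N) = of_bool (i = j))"
proof -
  have "mat_adjoint (modulation_matrix N m z) * modulation_matrix N mt z = 1\<^sub>m N \<longleftrightarrow>
      modulation_matrix N mt z * mat_adjoint (modulation_matrix N m z) = 1\<^sub>m N"
    by (rule mat_adjoint_mult_eq_one_iff) simp_all
  also have "\<dots> \<longleftrightarrow> (\<forall>j<N. \<forall>i<N. fibre_mean N (\<lambda>w. cnj (m i w) * mt j w) (z ^ N) = (if j = i then 1 else 0))"
    by (subst eq_one_mat_iff[of _ N])
      (auto simp: modulation_matrix_mult_adjoint[OF N z] simp del: index_mult_mat
        intro!: mult_carrier_mat[of _ N N])
  also have "\<dots> \<longleftrightarrow> (\<forall>i<N. \<forall>j<N. fibre_mean N (\<lambda>w. cnj (m i w) * mt j w) (z ^ N) = of_bool (i = j))"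
    by (auto simp: of_bool_def)
  finally show ?thesis .
qed

text \<open>
  Expanding the fibre mean and exchanging the sums, the coefficient of \<open>f\<close> at the point
  \<open>root_of_unity N l * z\<close> is the complex conjugate of the entry \<open>(0, l)\<close> of the matrix product, so only
  \<open>l = 0\<close> survives.
\<close>
lemma modulation_resolution_of_identity:
  assumes N: "N > 0" and z: "z \<noteq> 0"
    and inv: "mat_adjoint (modulation_matrix N m z) * modulation_matrix N mt z = 1\<^sub>m N"
  shows "(\<Sum>i<N. m i z * fibre_mean N (\<lambda>w. cnj (mt i w) * f w) (z ^ N)) = f z"
proof -
  \<comment> \<open>The entry \<open>(0, l)\<close> of the hypothesis, conjugated; column \<open>0\<close> of the modulation matrix belongs to \<open>z\<close>
    itself.\<close>
  have col: "(\<Sum>i<N. m i z * cnj (mt i (root_of_unity N l * z))) / of_nat N = of_bool (l = 0)"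
    if l: "l < N" for l
  proof -
    have "(\<Sum>i<N. cnj (m i z) * mt i (root_of_unity N l * z)) / of_nat N =
        (mat_adjoint (modulation_matrix N m z) * modulation_matrix N mt z) $$ (0, l)"
      using N l by (simp add: index_mat_adjoint_mult[OF modulation_matrix_carrier modulation_matrix_carrier]
          index_modulation_matrix complex_sqrt_mult_self sum_divide_distrib del: index_mult_mat)
    also have "\<dots> = of_bool (l = 0)"
      using N l by (auto simp: inv)
    finally have "cnj ((\<Sum>i<N. cnj (m i z) * mt i (root_of_unity N l * z)) / of_nat N) = cnj (of_bool (l = 0))"
      by simp
    then show ?thesis
      by simp
  qed
  have "(\<Sum>i<N. m i z * fibre_mean N (\<lambda>w. cnj (mt i w) * f w) (z ^ N)) =
      (\<Sum>i<N. \<Sum>l<N. f (root_of_unity N l * z) * (m i z * cnj (mt i (root_of_unity N l * z)) / of_nat N))"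
    by (simp add: fibre_mean_power[OF N z] sum_distrib_left sum_divide_distrib mult_ac)
  also have "\<dots> = (\<Sum>l<N. f (root_of_unity N l * z) *
      ((\<Sum>i<N. m i z * cnj (mt i (root_of_unity N l * z))) / of_nat N))"
    by (subst sum.swap) (simp add: sum_distrib_left sum_divide_distrib)
  also have "\<dots> = (\<Sum>l<N. if l = 0 then f (root_of_unity N l * z) else 0)"
    by (rule sum.cong) (simp_all add: col)
  also have "\<dots> = f z"
    using N by simp
  finally show ?thesis .
qed

text \<open>
  The change of basis from values on the fibre through \<open>z\<close> to polyphase components. It is the discrete
  Fourier transform up to a diagonal twist by powers of \<open>z\<close>.
\<close>
definition fourier_matrix :: "nat \<Rightarrow> complex \<Rightarrow> complex mat" where
  "fourier_matrix N z =
     mat N N (\<lambda>(j, l). (root_of_unity N j * z) powi (- int l) / complex_of_real (sqrt (real N)))"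

lemma fourier_matrix_carrier [simp]: "fourier_matrix N z \<in> carrier_mat N N"
  by (simp add: fourier_matrix_def)

lemma index_fourier_matrix:
  assumes "j < N" "l < N"
  shows "fourier_matrix N z $$ (j, l) =
    (root_of_unity N j * z) powi (- int l) / complex_of_real (sqrt (real N))"
  using assms by (simp add: fourier_matrix_def)

text \<open>
  Two points \<open>v\<close>, \<open>w\<close> of one fibre differ by an \<open>N\<close>-th root of unity \<open>w / v\<close>, whose powers sum to zero unless
  \<open>v = w\<close>.
\<close>
lemma fourier_matrix_unitary:
  assumes N: "N > 0" and z: "cmod z = 1"
  shows "mat_adjoint (fourier_matrix N z) * fourier_matrix N z = 1\<^sub>m N"
    and "fourier_matrix N z * mat_adjoint (fourier_matrix N z) = 1\<^sub>m N"
proof -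
  have z0: "z \<noteq> 0" using z by auto
  have "(fourier_matrix N z * mat_adjoint (fourier_matrix N z)) $$ (i, j) = (if i = j then 1 else 0)"
    if ij: "i < N" "j < N" for i j
  proof -
    define v w where "v = root_of_unity N i * z" and "w = root_of_unity N j * z"
    have vw: "v \<noteq> 0" "w \<noteq> 0" "cmod v = 1" "cmod w = 1"
      using z0 z by (auto simp: v_def w_def norm_mult)
    have vwN: "v ^ N = z ^ N" "w ^ N = z ^ N"
      using bij_betw_fibre[OF N z0] ij by (auto simp: bij_betw_def v_def w_def)
    have eq: "v = w \<longleftrightarrow> i = j"
      using bij_betw_fibre[OF N z0] ij by (auto simp: bij_betw_def v_def w_def inj_on_def)
    have quotient: "v powi (- int l) * cnj (w powi (- int l)) = (w / v) ^ l" for l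
    proof -
      have "cnj w = inverse w"
        using vw divide_conv_cnj[of w 1] by (simp add: inverse_eq_divide)
      then show ?thesis
        by (simp add: power_int_minus power_divide field_simps)
    qed
    have "(fourier_matrix N z * mat_adjoint (fourier_matrix N z)) $$ (i, j) =
        (\<Sum>l<N. v powi (- int l) / complex_of_real (sqrt (real N)) *
          cnj (w powi (- int l) / complex_of_real (sqrt (real N))))"
      unfolding index_mult_mat_adjoint[OF fourier_matrix_carrier fourier_matrix_carrier ij]
      by (rule sum.cong) (simp_all add: index_fourier_matrix ij v_def w_def)
    also have "\<dots> = (\<Sum>l<N. v powi (- int l) * cnj (w powi (- int l)) / of_nat N)"
      by (rule sum.cong) (simp_all add: complex_sqrt_mult_self)
    also have "\<dots> = (\<Sum>l<N. (w / v) ^ l) / of_nat N"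
      by (simp only: quotient sum_divide_distrib)
    also have "\<dots> = (if i = j then 1 else 0)"
    proof (cases "i = j")
      case True
      then show ?thesis using eq vw N by simp
    next
      case False
      then have "w / v \<noteq> 1" using eq vw by auto
      moreover have "(w / v) ^ N = 1"
        using vwN z0 by (simp add: power_divide)
      ultimately have "(\<Sum>l<N. (w / v) ^ l) = 0"
        using geometric_sum[of "w / v" N] by simp
      then show ?thesis using False by simp
    qed
    finally show ?thesis .
  qed
  then show 1: "fourier_matrix N z * mat_adjoint (fourier_matrix N z) = 1\<^sub>m N"
    by (subst eq_one_mat_iff[of _ N]) (auto simp del: index_mult_mat intro!: mult_carrier_mat[of _ N N])
  then show "mat_adjoint (fourier_matrix N z) * fourier_matrix N z = 1\<^sub>m N"
    using mat_adjoint_mult_eq_one_iff[of "fourier_matrix N z" N "fourier_matrix N z"] by simp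
qed

definition polyphase_matrix :: "nat \<Rightarrow> (nat \<Rightarrow> complex \<Rightarrow> complex) \<Rightarrow> complex \<Rightarrow> complex mat" where
  "polyphase_matrix N m z = mat N N (\<lambda>(k, l). polyphase N m k l z)"

lemma polyphase_matrix_carrier [simp]: "polyphase_matrix N m z \<in> carrier_mat N N"
  by (simp add: polyphase_matrix_def)

lemma index_polyphase_matrix [simp]:
  "k < N \<Longrightarrow> l < N \<Longrightarrow> polyphase_matrix N m z $$ (k, l) = polyphase N m k l z"
  by (simp add: polyphase_matrix_def)

lemma polyphase_matrix_power:
  assumes N: "N > 0" and z: "z \<noteq> 0"
  shows "polyphase_matrix N m (z ^ N) = modulation_matrix N m z * fourier_matrix N z"
proof (rule eq_matI)
  fix k l assume "k < dim_row (modulation_matrix N m z * fourier_matrix N z)"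
    "l < dim_col (modulation_matrix N m z * fourier_matrix N z)"
  then have kl: "k < N" "l < N"
    by (simp_all add: modulation_matrix_def fourier_matrix_def)
  have "polyphase N m k l (z ^ N) = fibre_mean N (\<lambda>w. w powi (- int l) * m k w) (z ^ N)"
    by (simp add: polyphase_def fibre_mean_def)
  also have "\<dots> = (\<Sum>j<N. modulation_matrix N m z $$ (k, j) * fourier_matrix N z $$ (j, l))"
    using kl by (simp add: fibre_mean_power[OF N z] index_modulation_matrix fourier_matrix_def
        complex_sqrt_mult_self sum_divide_distrib mult.commute)
  also have "\<dots> = (modulation_matrix N m z * fourier_matrix N z) $$ (k, l)"
    using kl carrier_matD[OF modulation_matrix_carrier, of N m z] carrier_matD[OF fourier_matrix_carrier, of N z]
    by (auto simp: scalar_prod_def lessThan_atLeast0 intro!: sum.cong)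
  finally show "polyphase_matrix N m (z ^ N) $$ (k, l) = (modulation_matrix N m z * fourier_matrix N z) $$ (k, l)"
    using kl by (simp add: polyphase_matrix_def)
qed (simp_all add: polyphase_matrix_def modulation_matrix_def fourier_matrix_def)

lemma unitary_conjugation_eq_one_iff:
  fixes X U :: "complex mat"
  assumes X: "X \<in> carrier_mat n n" and U: "U \<in> carrier_mat n n"
    and UU: "mat_adjoint U * U = 1\<^sub>m n" "U * mat_adjoint U = 1\<^sub>m n"
  shows "mat_adjoint U * X * U = 1\<^sub>m n \<longleftrightarrow> X = 1\<^sub>m n"
proof
  have V: "mat_adjoint U \<in> carrier_mat n n"
    using U by simp
  assume *: "mat_adjoint U * X * U = 1\<^sub>m n"
  have "X = (U * mat_adjoint U) * X * (U * mat_adjoint U)"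
    using X by (simp add: UU)
  also have "\<dots> = U * (mat_adjoint U * X * U) * mat_adjoint U"
    using X U V by (simp add: assoc_mult_mat[of _ n n _ n _ n] mult_carrier_mat[of _ n n _ n])
  also have "\<dots> = 1\<^sub>m n"
    using U by (simp add: * UU)
  finally show "X = 1\<^sub>m n" .
qed (use U UU in simp)

text \<open>
  The polyphase matrices at \<open>z ^ N\<close> arise from the modulation matrices at \<open>z\<close> through one and the same
  unitary factor, so their product is a unitary conjugate of the product of the modulation matrices.
\<close>
lemma modulation_biorthogonal_iff_polyphase:
  assumes N: "N > 0" and z: "cmod z = 1"
  shows "mat_adjoint (modulation_matrix N m z) * modulation_matrix N mt z = 1\<^sub>m N \<longleftrightarrow>
    (\<forall>i<N. \<forall>j<N. (\<Sum>k<N. cnj (polyphase N m k i (z ^ N)) * polyphase N mt k j (z ^ N)) =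
      (if i = j then 1 else 0))"
proof -
  let ?M = "modulation_matrix N m z" and ?Mt = "modulation_matrix N mt z" and ?U = "fourier_matrix N z"
  have z0: "z \<noteq> 0" using z by auto
  have c: "?M \<in> carrier_mat N N" "?Mt \<in> carrier_mat N N" "?U \<in> carrier_mat N N"
    "mat_adjoint ?M \<in> carrier_mat N N" "mat_adjoint ?U \<in> carrier_mat N N"
    by simp_all
  have "(\<forall>i<N. \<forall>j<N. (\<Sum>k<N. cnj (polyphase N m k i (z ^ N)) * polyphase N mt k j (z ^ N)) =
      (if i = j then 1 else 0)) \<longleftrightarrow>
      mat_adjoint (polyphase_matrix N m (z ^ N)) * polyphase_matrix N mt (z ^ N) = 1\<^sub>m N"
    by (subst eq_one_mat_iff[of _ N])
      (simp_all add: index_mat_adjoint_mult[OF polyphase_matrix_carrier polyphase_matrix_carrier]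
        mult_carrier_mat[of _ N N] del: index_mult_mat cong: imp_cong)
  also have "mat_adjoint (polyphase_matrix N m (z ^ N)) * polyphase_matrix N mt (z ^ N) =
      mat_adjoint ?U * (mat_adjoint ?M * ?Mt) * ?U"
    using c by (simp add: polyphase_matrix_power[OF N z0] mat_adjoint_mult[of _ N N _ N]
        assoc_mult_mat[of _ N N _ N _ N] mult_carrier_mat[of _ N N _ N])
  also have "\<dots> = 1\<^sub>m N \<longleftrightarrow> mat_adjoint ?M * ?Mt = 1\<^sub>m N"
    by (rule unitary_conjugation_eq_one_iff)
      (auto intro!: fourier_matrix_unitary N z mult_carrier_mat[of _ N N])
  finally show ?thesis by simp
qed



section \<open>Equivalence of the three conditions\<close>

theorem theorem2p8:
  fixes N :: nat and m mt :: "nat \<Rightarrow> complex \<Rightarrow> complex"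
    and S St :: "nat \<Rightarrow> l2_circle \<Rightarrow> l2_circle"
    and A At :: "nat \<Rightarrow> nat \<Rightarrow> complex \<Rightarrow> complex"
  assumes "N \<ge> 2"
    and "\<And>i. i < N \<Longrightarrow> m i \<in> Linf_circle"
    and "\<And>i. i < N \<Longrightarrow> mt i \<in> Linf_circle"
  defines "S \<equiv> \<lambda>i. filter_op N (m i)"
    and "St \<equiv> \<lambda>i. filter_op N (mt i)"
    and "A \<equiv> polyphase N m"
    and "At \<equiv> polyphase N mt"
  defines "cond_i \<equiv>
      (\<forall>i<N. \<forall>j<N. l2_adjoint (S i) \<circ> St j = (if i = j then id else (\<lambda>_. 0))) \<and>
      (\<lambda>f. \<Sum>i<N. S i (l2_adjoint (St i) f)) = id"
    and "cond_ii \<equiv>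
      (AE z in circle_measure.
         invertible_mat (modulation_matrix N m z) \<and>
         invertible_mat (modulation_matrix N mt z) \<and>
         inverts_mat (mat_adjoint (modulation_matrix N m z)) (modulation_matrix N mt z) \<and>
         inverts_mat (modulation_matrix N mt z) (mat_adjoint (modulation_matrix N m z)))"
    and "cond_iii \<equiv>
      (AE z in circle_measure. \<forall>i<N. \<forall>j<N.
         (\<Sum>k<N. cnj (A k i z) * At k j z) = (if i = j then 1 else 0))"
  shows "(cond_i \<longleftrightarrow> cond_ii) \<and> (cond_ii \<longleftrightarrow> cond_iii)"
proof -
  note m = assms(2) and mt = assms(3)
  have N: "N > 0" using assms(1) by simp
  \<comment> \<open>Biorthogonality at a single point; each of the three conditions is shown to say that it holds
    almost everywhere.\<close>
  define D where
    "D z \<longleftrightarrow> mat_adjoint (modulation_matrix N m z) * modulation_matrix N mt z = 1\<^sub>m N" for z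
  have ii: "cond_ii \<longleftrightarrow> (AE z in circle_measure. D z)"
    unfolding cond_ii_def D_def
    by (simp only: adjoint_inverse_iff[OF modulation_matrix_carrier modulation_matrix_carrier])
  have iii: "cond_iii \<longleftrightarrow> (AE z in circle_measure. D z)"
    unfolding cond_iii_def A_def At_def
    by (rule AE_circle_power_iff[OF N, symmetric])
      (simp only: D_def modulation_biorthogonal_iff_polyphase[OF N])
  have D_iff: "(AE z in circle_measure. D z) \<longleftrightarrow>
      (\<forall>i<N. \<forall>j<N. l2_adjoint (S i) \<circ> St j = (if i = j then id else (\<lambda>_. 0)))"
  proof -
    have "(AE z in circle_measure. D z) \<longleftrightarrow>
        (AE z in circle_measure. \<forall>i\<in>{..<N}. \<forall>j\<in>{..<N}.
          fibre_mean N (\<lambda>w. cnj (m i w) * mt j w) z = of_bool (i = j))"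
      by (rule AE_circle_power_iff[OF N], unfold D_def, subst modulation_biorthogonal_iff_fibre_mean[OF N])
        auto
    also have "\<dots> \<longleftrightarrow> (\<forall>i<N. \<forall>j<N. AE z in circle_measure.
        fibre_mean N (\<lambda>w. cnj (m i w) * mt j w) z = of_bool (i = j))"
      unfolding AE_finite_all[OF finite_lessThan] by (simp only: Ball_def lessThan_iff)
    also have "\<dots> \<longleftrightarrow> (\<forall>i<N. \<forall>j<N. l2_adjoint (S i) \<circ> St j = (if i = j then id else (\<lambda>_. 0)))"
      unfolding S_def St_def by (simp only: l2_adjoint_filter_op_filter_op_eq_iff[OF N m mt] cong: imp_cong)
    finally show ?thesis .
  qed
  have resolution: "(\<lambda>f. \<Sum>i<N. S i (l2_adjoint (St i) f)) = id" if D: "AE z in circle_measure. D z"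
  proof
    fix x
    obtain f where f: "square_integrable f" "x = abs_l2_circle f" by (rule l2_circle_cases)
    have "AE z in circle_measure. z \<noteq> 0"
      by (rule AE_I2) (auto simp: space_circle_measure)
    with D have "AE z in circle_measure.
        (\<Sum>i<N. m i z * fibre_mean N (\<lambda>w. cnj (mt i w) * f w) (z ^ N)) = f z"
      by eventually_elim (simp add: D_def modulation_resolution_of_identity[OF N])
    then show "(\<Sum>i<N. S i (l2_adjoint (St i) x)) = id x"
      using sum_filter_op_l2_adjoint[OF N m mt f(1)] f
      by (simp add: S_def St_def abs_l2_circle_eq_iff)
  qed
  have "cond_i \<longleftrightarrow> (AE z in circle_measure. D z)"
    unfolding cond_i_def using D_iff resolution by blast
  then show ?thesis
    using ii iii by blast
qed

end
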